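(* Let $\mathcal{U}\subseteq\mathbb{F}^n$ be a primitive $\alpha$-hypercircle. The pencil of hyperplanes $H_t:\ X_0+X_1\alpha+\cdots+X_{n-1}\alpha^{n-1}=t$ parametrizes $\mathcal{U}$; that is, for all but finitely many $t\in\mathbb{F}$ the affine hyperplane $H_t$ meets $\mathcal{U}$ in exactly one point of $\mathbb{F}^n$, the coordinates of this point are rational functions of $t$, and these rational functions form a parametrization of $\mathcal{U}$.
   Context: $\mathbb{K}$ is a field of characteristic zero, $\mathbb{L}=\mathbb{K}(\alpha)$ is a finite algebraic extension of $\mathbb{K}$ of degree $n$ with primitive element $\alpha$, and $\mathbb{F}$ is the algebraic closure of $\mathbb{K}$. A unit of $\mathbb{L}(t)$ (under composition) is a rational function $u(t)=\frac{at+b}{ct+d}$ with $a,b,c,d\in\mathbb{L}$, $ad-bc\neq 0$. Every unit $u(t)\in\mathbb{L}(t)$ is written uniquely as $u(t)=\sum_{i=0}^{n-1}\phi_i(t)\alpha^i$ with $\phi_i(t)\in\mathbb{K}(t)$, and the $\alpha$-hypercircle generated by $u(t)$ is the rational curve in $\mathbb{F}^n$ parametrized by $(\phi_0(t),\ldots,\phi_{n-1}(t))$ (Zariski closure of the image). An $\alpha$-hypercircle is primitive if its degree as a curve equals $n=[\mathbb{K}(\alpha):\mathbb{K}]$. *)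

theory Defs
  imports
    "HOL-Algebra.Algebraic_Closure_Type"
    "HOL-Computational_Algebra.Computational_Algebra"
    "HOL-Library.Poly_Mapping"
    "HOL-Library.FuncSet"
begin

text \<open>
  The base field is a type \<open>'k :: field_char_0\<close>, its algebraic closure is \<open>'k alg_closure\<close>, with
  embedding \<open>to_ac\<close>. A finite extension of the base field is algebraic, hence is taken inside
  \<open>'k alg_closure\<close>, generated by an element \<open>\<alpha>\<close>.
\<close>

definition is_subfield :: "'a::field set \<Rightarrow> bool" where
  "is_subfield S \<longleftrightarrow> 0 \<in> S \<and> 1 \<in> S \<and>
     (\<forall>x\<in>S. \<forall>y\<in>S. x + y \<in> S \<and> x * y \<in> S) \<and> (\<forall>x\<in>S. - x \<in> S \<and> inverse x \<in> S)"

definition base_field :: "'k::field alg_closure set" where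
  "base_field = range to_ac"

definition simple_ext :: "'k::field alg_closure \<Rightarrow> 'k alg_closure set" where
  "simple_ext \<alpha> = is_subfield hull (insert \<alpha> base_field)"

definition ext_degree :: "'k::field alg_closure \<Rightarrow> nat" where
  "ext_degree \<alpha> = vector_space.dim (\<lambda>c x. to_ac c * x) (simple_ext \<alpha>)"

text \<open>Rational functions with coefficients in the set \<open>S\<close>: for a subfield \<open>S\<close> this is \<open>S(t)\<close>,
  seen inside the field of rational functions over the whole type.\<close>

definition ratfuns_over :: "'a::field set \<Rightarrow> 'a poly fract set" where
  "ratfuns_over S =
     {Fract p q | p q. range (Polynomial.coeff p) \<subseteq> S \<and> range (Polynomial.coeff q) \<subseteq> S \<and> q \<noteq> 0}"

text \<open>\<open>quot_of_fract\<close> yields numerator and denominator in lowest terms.\<close>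

definition rat_defined_at :: "'k::field alg_closure poly fract \<Rightarrow> 'k alg_closure \<Rightarrow> bool" where
  "rat_defined_at f t \<longleftrightarrow> poly (snd (quot_of_fract f)) t \<noteq> 0"

definition rat_eval :: "'k::field alg_closure poly fract \<Rightarrow> 'k alg_closure \<Rightarrow> 'k alg_closure" where
  "rat_eval f t = poly (fst (quot_of_fract f)) t / poly (snd (quot_of_fract f)) t"

definition aff_space :: "nat \<Rightarrow> (nat \<Rightarrow> 'a) set" where
  "aff_space n = ({..<n} \<rightarrow>\<^sub>E UNIV)"

text \<open>Polynomials in the variables \<open>X\<^sub>0, X\<^sub>1, \<dots>\<close>: finitely supported maps from
  exponent vectors to coefficients.\<close>

type_synonym 'a multipoly = "(nat \<Rightarrow>\<^sub>0 nat) \<Rightarrow>\<^sub>0 'a"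

definition multipoly_ring :: "nat \<Rightarrow> 'a::comm_ring_1 multipoly set" where
  "multipoly_ring n = {p. \<forall>m\<in>Poly_Mapping.keys p. Poly_Mapping.keys m \<subseteq> {..<n}}"

definition multipoly_eval :: "'a::comm_ring_1 multipoly \<Rightarrow> (nat \<Rightarrow> 'a) \<Rightarrow> 'a" where
  "multipoly_eval p x = (\<Sum>m\<in>Poly_Mapping.keys p. Poly_Mapping.lookup p m * (\<Prod>i\<in>Poly_Mapping.keys m. x i ^ Poly_Mapping.lookup m i))"

definition zariski_closure :: "nat \<Rightarrow> (nat \<Rightarrow> 'a::comm_ring_1) set \<Rightarrow> (nat \<Rightarrow> 'a) set" where
  "zariski_closure n S = {x \<in> aff_space n. \<forall>p\<in>multipoly_ring n.
     (\<forall>y\<in>S. multipoly_eval p y = 0) \<longrightarrow> multipoly_eval p x = 0}"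

text \<open>\<open>C\<close> is a curve of degree \<open>d\<close>: a generic hyperplane
  \<open>a\<^sub>0 X\<^sub>0 + \<dots> + a\<^sub>n\<^sub>-\<^sub>1 X\<^sub>n\<^sub>-\<^sub>1 = a\<^sub>n\<close> meets \<open>C\<close> in exactly \<open>d\<close> points. Generic means outside the
  zero set of a nonzero polynomial \<open>g\<close> in \<open>a\<^sub>0, \<dots>, a\<^sub>n\<close>. Since a generic hyperplane avoids the
  finitely many points at infinity of a curve, this is also the degree of the projective closure.\<close>

definition has_curve_degree :: "nat \<Rightarrow> (nat \<Rightarrow> 'a::field) set \<Rightarrow> nat \<Rightarrow> bool" where
  "has_curve_degree n C d \<longleftrightarrow> (\<exists>g \<in> multipoly_ring (Suc n). g \<noteq> 0 \<and>
     (\<forall>a. multipoly_eval g a \<noteq> 0 \<longrightarrow>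
        finite {x\<in>C. (\<Sum>i<n. a i * x i) = a n} \<and> card {x\<in>C. (\<Sum>i<n. a i * x i) = a n} = d))"

text \<open>A tuple of \<open>n\<close> rational functions is a function on \<open>nat\<close> of which only the values
  at \<open>i < n\<close> matter.\<close>

definition tuple_defined_at ::
  "nat \<Rightarrow> (nat \<Rightarrow> 'k::field alg_closure poly fract) \<Rightarrow> 'k alg_closure \<Rightarrow> bool" where
  "tuple_defined_at n \<phi> t \<longleftrightarrow> (\<forall>i<n. rat_defined_at (\<phi> i) t)"

definition tuple_eval ::
  "nat \<Rightarrow> (nat \<Rightarrow> 'k::field alg_closure poly fract) \<Rightarrow> 'k alg_closure \<Rightarrow> nat \<Rightarrow> 'k alg_closure" where
  "tuple_eval n \<phi> t = (\<lambda>i\<in>{..<n}. rat_eval (\<phi> i) t)"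

definition parametrizes ::
  "nat \<Rightarrow> (nat \<Rightarrow> 'k::field alg_closure poly fract) \<Rightarrow> (nat \<Rightarrow> 'k alg_closure) set \<Rightarrow> bool" where
  "parametrizes n \<phi> C \<longleftrightarrow> C = zariski_closure n {tuple_eval n \<phi> t | t. tuple_defined_at n \<phi> t}"

definition unit_ratfuns :: "'k::field alg_closure \<Rightarrow> 'k alg_closure poly fract set" where
  "unit_ratfuns \<alpha> = {Fract [:b, a:] [:d, c:] | a b c d.
     {a, b, c, d} \<subseteq> simple_ext \<alpha> \<and> a * d - b * c \<noteq> 0}"

text \<open>The components of \<open>u\<close> with respect to the basis \<open>1, \<alpha>, \<dots>, \<alpha>\<^sup>n\<^sup>-\<^sup>1\<close>; they exist and are unique
  for every \<open>u\<close> in \<open>ratfuns_over (simple_ext \<alpha>)\<close>.\<close>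

definition is_expansion ::
  "'k::field alg_closure \<Rightarrow> 'k alg_closure poly fract \<Rightarrow> (nat \<Rightarrow> 'k alg_closure poly fract) \<Rightarrow> bool" where
  "is_expansion \<alpha> u \<phi> \<longleftrightarrow> (\<forall>i<ext_degree \<alpha>. \<phi> i \<in> ratfuns_over base_field) \<and>
     u = (\<Sum>i<ext_degree \<alpha>. \<phi> i * to_fract [:\<alpha> ^ i:])"

definition is_hypercircle :: "'k::field alg_closure \<Rightarrow> (nat \<Rightarrow> 'k alg_closure) set \<Rightarrow> bool" where
  "is_hypercircle \<alpha> U \<longleftrightarrow>
     (\<exists>u\<in>unit_ratfuns \<alpha>. \<exists>\<phi>. is_expansion \<alpha> u \<phi> \<and> parametrizes (ext_degree \<alpha>) \<phi> U)"

definition is_primitive_hypercircle ::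
  "'k::field alg_closure \<Rightarrow> (nat \<Rightarrow> 'k alg_closure) set \<Rightarrow> bool" where
  "is_primitive_hypercircle \<alpha> U \<longleftrightarrow>
     is_hypercircle \<alpha> U \<and> has_curve_degree (ext_degree \<alpha>) U (ext_degree \<alpha>)"

definition pencil_hyperplane :: "'k::field alg_closure \<Rightarrow> 'k alg_closure \<Rightarrow> (nat \<Rightarrow> 'k alg_closure) set" where
  "pencil_hyperplane \<alpha> t = {x \<in> aff_space (ext_degree \<alpha>). (\<Sum>i<ext_degree \<alpha>. x i * \<alpha> ^ i) = t}"

end

theory Submission
  imports Defs
begin

text \<open>
  Let \<open>u\<close> be the unit generating \<open>U\<close> with components \<open>\<phi>\<^sub>i\<close>, and put \<open>\<psi>\<^sub>i = \<phi>\<^sub>i \<circ> u\<^sup>-\<^sup>1\<close>.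
  Reparametrizing by a Moebius transformation changes the image only in finitely many parameters,
  which does not affect its Zariski closure, so \<open>\<psi>\<close> parametrizes \<open>U\<close> as well. Composing
  \<open>u = \<Sum>\<^sub>i \<phi>\<^sub>i \<alpha>\<^sup>i\<close> with \<open>u\<^sup>-\<^sup>1\<close> gives \<open>\<Sum>\<^sub>i \<psi>\<^sub>i \<alpha>\<^sup>i = t\<close>, so \<open>\<psi>(t)\<close> lies on \<open>H\<^sub>t\<close>. It is the only
  point of \<open>U\<close> there: writing \<open>\<psi>\<^sub>i = P\<^sub>i / Q\<^sub>i\<close> and \<open>L = \<Sum>\<^sub>i X\<^sub>i \<alpha>\<^sup>i\<close>, the polynomial
  \<open>Q\<^sub>i(L) X\<^sub>i - P\<^sub>i(L)\<close> vanishes on the image of \<open>\<psi>\<close>, hence on \<open>U\<close>, and this forces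
  \<open>x\<^sub>i = P\<^sub>i(t) / Q\<^sub>i(t)\<close> for every \<open>x\<close> in \<open>U \<inter> H\<^sub>t\<close>.
\<close>

section \<open>Polynomial functions in several variables\<close>

text \<open>Inserting a fresh key into a finitely supported map is the same as adding one term.
  Statements compatible with sums thereby reduce to single terms, which is how evaluation is shown
  to be multiplicative.\<close>

lemma multipoly_induct:
  fixes p :: "'a::comm_ring_1 multipoly"
  assumes "P 0" "\<And>m c. P (Poly_Mapping.single m c)" "\<And>p q. P p \<Longrightarrow> P q \<Longrightarrow> P (p + q)"
  shows "P p"
proof (induction p rule: update_induct)
  case const
  show ?case by (fact assms(1))
next
  case (update f a b)
  have "Poly_Mapping.update a b f = f + Poly_Mapping.single a b"
    using update(1)
    by (intro poly_mapping_eqI) (auto simp: lookup_update lookup_add lookup_single in_keys_iff when_def)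
  then show ?case using update assms by simp
qed

definition monomial_eval :: "(nat \<Rightarrow>\<^sub>0 nat) \<Rightarrow> (nat \<Rightarrow> 'a::comm_ring_1) \<Rightarrow> 'a" where
  "monomial_eval m x = (\<Prod>i\<in>Poly_Mapping.keys m. x i ^ Poly_Mapping.lookup m i)"

text \<open>Extra indices carry exponent 0 and contribute a factor 1. This brings two monomials with
  different supports to a common index set.\<close>

lemma monomial_eval_superset:
  assumes "finite A" "Poly_Mapping.keys m \<subseteq> A"
  shows "monomial_eval m x = (\<Prod>i\<in>A. x i ^ Poly_Mapping.lookup m i)"
  unfolding monomial_eval_def
  using assms by (intro prod.mono_neutral_left) (auto simp: in_keys_iff)

lemma monomial_eval_add: "monomial_eval (m + m') x = monomial_eval m x * monomial_eval m' x"
proof -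
  let ?A = "Poly_Mapping.keys m \<union> Poly_Mapping.keys m'"
  have "monomial_eval (m + m') x = (\<Prod>i\<in>?A. x i ^ Poly_Mapping.lookup (m + m') i)"
    using keys_add[of m m'] by (intro monomial_eval_superset) auto
  also have "\<dots> = monomial_eval m x * monomial_eval m' x"
    by (simp add: monomial_eval_superset[of ?A m] monomial_eval_superset[of ?A m']
        lookup_add power_add prod.distrib)
  finally show ?thesis .
qed

lemma multipoly_eval_monomials:
  "multipoly_eval p x = (\<Sum>m\<in>Poly_Mapping.keys p. Poly_Mapping.lookup p m * monomial_eval m x)"
  by (simp add: multipoly_eval_def monomial_eval_def)

lemma multipoly_eval_0: "multipoly_eval 0 x = 0"
  by (simp add: multipoly_eval_def)

lemma multipoly_eval_single:
  "multipoly_eval (Poly_Mapping.single m c) x = c * monomial_eval m x"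
  by (simp add: multipoly_eval_monomials)

lemma multipoly_eval_add: "multipoly_eval (p + q) x = multipoly_eval p x + multipoly_eval q x"
  unfolding multipoly_eval_monomials
  by (rule setsum_keys_plus_distrib) (simp_all add: algebra_simps)

lemma multipoly_eval_single_mult:
  "multipoly_eval (Poly_Mapping.single m c * q) x = c * monomial_eval m x * multipoly_eval q x"
  by (induction q rule: multipoly_induct)
    (simp_all add: multipoly_eval_0 multipoly_eval_single mult_single monomial_eval_add
      multipoly_eval_add algebra_simps)

lemma multipoly_eval_mult: "multipoly_eval (p * q) x = multipoly_eval p x * multipoly_eval q x"
  by (induction p rule: multipoly_induct)
    (simp_all add: multipoly_eval_0 multipoly_eval_single_mult multipoly_eval_single
      multipoly_eval_add distrib_right)

text \<open>The Zariski closure is tested by elements of \<open>multipoly_ring n\<close>. Passing to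
  the induced functions allows equations to be assembled by closure rules, without computing
  coefficients.\<close>

definition polynomial_function :: "nat \<Rightarrow> ((nat \<Rightarrow> 'a::comm_ring_1) \<Rightarrow> 'a) \<Rightarrow> bool" where
  "polynomial_function n f \<longleftrightarrow> (\<exists>p\<in>multipoly_ring n. \<forall>x. multipoly_eval p x = f x)"

lemma polynomial_function_const: "polynomial_function n (\<lambda>x. c)"
  unfolding polynomial_function_def
  by (rule bexI[of _ "Poly_Mapping.single 0 c"])
    (auto simp: multipoly_eval_single monomial_eval_def multipoly_ring_def)

lemma polynomial_function_coord: "i < n \<Longrightarrow> polynomial_function n (\<lambda>x. x i)"
  unfolding polynomial_function_def
  by (rule bexI[of _ "Poly_Mapping.single (Poly_Mapping.single i 1) 1"])
    (auto simp: multipoly_eval_single monomial_eval_def multipoly_ring_def)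

lemma polynomial_function_add:
  assumes "polynomial_function n f" "polynomial_function n g"
  shows "polynomial_function n (\<lambda>x. f x + g x)"
proof -
  obtain p q where "p \<in> multipoly_ring n" "q \<in> multipoly_ring n"
    "\<And>x. multipoly_eval p x = f x" "\<And>x. multipoly_eval q x = g x"
    using assms unfolding polynomial_function_def by blast
  moreover from this have "p + q \<in> multipoly_ring n"
    using keys_add[of p q] unfolding multipoly_ring_def by blast
  ultimately show ?thesis
    unfolding polynomial_function_def by (metis multipoly_eval_add)
qed

lemma polynomial_function_mult:
  assumes "polynomial_function n f" "polynomial_function n g"
  shows "polynomial_function n (\<lambda>x. f x * g x)"
proof -
  obtain p q where pq: "p \<in> multipoly_ring n" "q \<in> multipoly_ring n"
    "\<And>x. multipoly_eval p x = f x" "\<And>x. multipoly_eval q x = g x"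
    using assms unfolding polynomial_function_def by blast
  have "Poly_Mapping.keys m \<subseteq> {..<n}" if m: "m \<in> Poly_Mapping.keys (p * q)" for m
  proof -
    obtain a b where "m = a + b" "a \<in> Poly_Mapping.keys p" "b \<in> Poly_Mapping.keys q"
      using m keys_mult[of p q] by blast
    then show ?thesis
      using pq(1,2) keys_add[of a b] unfolding multipoly_ring_def by blast
  qed
  then have "p * q \<in> multipoly_ring n"
    unfolding multipoly_ring_def by blast
  with pq show ?thesis
    unfolding polynomial_function_def by (metis multipoly_eval_mult)
qed

lemma polynomial_function_diff:
  assumes "polynomial_function n f" "polynomial_function n g"
  shows "polynomial_function n (\<lambda>x. f x - g x)"
  using polynomial_function_add[OF assms(1)
      polynomial_function_mult[OF polynomial_function_const[of n "- 1"] assms(2)]]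
  by simp

lemma polynomial_function_sum:
  assumes "\<And>i. i \<in> A \<Longrightarrow> polynomial_function n (f i)"
  shows "polynomial_function n (\<lambda>x. \<Sum>i\<in>A. f i x)"
  using assms
  by (induction A rule: infinite_finite_induct)
    (simp_all add: polynomial_function_const polynomial_function_add)

lemma polynomial_function_poly:
  assumes "polynomial_function n f"
  shows "polynomial_function n (\<lambda>x. poly p (f x))"
  using assms
  by (induction p)
    (simp_all add: polynomial_function_const polynomial_function_add polynomial_function_mult)

section \<open>Rational functions of one variable\<close>

text \<open>A single fraction, not necessarily in lowest terms, represents \<open>f\<close> on all
  of \<open>D\<close> without poles there. Sums, products and compositions can then be treated
  pointwise, with no normalization of fractions.\<close>

definition regular_on :: "'a::field set \<Rightarrow> ('a \<Rightarrow> 'a) \<Rightarrow> bool" where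
  "regular_on D f \<longleftrightarrow> (\<exists>p q. \<forall>t\<in>D. poly q t \<noteq> 0 \<and> f t = poly p t / poly q t)"

lemma regular_onI:
  assumes "\<And>t. t \<in> D \<Longrightarrow> poly q t \<noteq> 0" "\<And>t. t \<in> D \<Longrightarrow> f t = poly p t / poly q t"
  shows "regular_on D f"
  using assms unfolding regular_on_def by blast

lemma regular_onE:
  assumes "regular_on D f"
  obtains p q where "\<And>t. t \<in> D \<Longrightarrow> poly q t \<noteq> 0" "\<And>t. t \<in> D \<Longrightarrow> f t = poly p t / poly q t"
  using assms unfolding regular_on_def by blast

lemma regular_on_const: "regular_on D (\<lambda>t. c)"
  by (rule regular_onI[of D 1 _ "[:c:]"]) auto

lemma regular_on_add:
  assumes "regular_on D f" "regular_on D g"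
  shows "regular_on D (\<lambda>t. f t + g t)"
proof -
  obtain p q where f: "\<And>t. t \<in> D \<Longrightarrow> poly q t \<noteq> 0" "\<And>t. t \<in> D \<Longrightarrow> f t = poly p t / poly q t"
    using assms(1) by (elim regular_onE) blast
  obtain r s where g: "\<And>t. t \<in> D \<Longrightarrow> poly s t \<noteq> 0" "\<And>t. t \<in> D \<Longrightarrow> g t = poly r t / poly s t"
    using assms(2) by (elim regular_onE) blast
  show ?thesis
    by (rule regular_onI[of D "q * s" _ "p * s + r * q"]) (use f g in \<open>auto simp: add_frac_eq\<close>)
qed

lemma regular_on_mult:
  assumes "regular_on D f" "regular_on D g"
  shows "regular_on D (\<lambda>t. f t * g t)"
proof -
  obtain p q where f: "\<And>t. t \<in> D \<Longrightarrow> poly q t \<noteq> 0" "\<And>t. t \<in> D \<Longrightarrow> f t = poly p t / poly q t"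
    using assms(1) by (elim regular_onE) blast
  obtain r s where g: "\<And>t. t \<in> D \<Longrightarrow> poly s t \<noteq> 0" "\<And>t. t \<in> D \<Longrightarrow> g t = poly r t / poly s t"
    using assms(2) by (elim regular_onE) blast
  show ?thesis
    by (rule regular_onI[of D "q * s" _ "p * r"]) (use f g in auto)
qed

lemma regular_on_divide:
  assumes "regular_on D f" "regular_on D g" "\<And>t. t \<in> D \<Longrightarrow> g t \<noteq> 0"
  shows "regular_on D (\<lambda>t. f t / g t)"
proof -
  obtain p q where f: "\<And>t. t \<in> D \<Longrightarrow> poly q t \<noteq> 0" "\<And>t. t \<in> D \<Longrightarrow> f t = poly p t / poly q t"
    using assms(1) by (elim regular_onE) blast
  obtain r s where g: "\<And>t. t \<in> D \<Longrightarrow> poly s t \<noteq> 0" "\<And>t. t \<in> D \<Longrightarrow> g t = poly r t / poly s t"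
    using assms(2) by (elim regular_onE) blast
  show ?thesis
    by (rule regular_onI[of D "q * r" _ "p * s"]) (use f g assms(3) in auto)
qed

lemma regular_on_sum:
  assumes "\<And>i. i \<in> A \<Longrightarrow> regular_on D (f i)"
  shows "regular_on D (\<lambda>t. \<Sum>i\<in>A. f i t)"
  using assms
  by (induction A rule: infinite_finite_induct) (simp_all add: regular_on_const regular_on_add)

lemma regular_on_prod:
  assumes "\<And>i. i \<in> A \<Longrightarrow> regular_on D (f i)"
  shows "regular_on D (\<lambda>t. \<Prod>i\<in>A. f i t)"
  using assms
  by (induction A rule: infinite_finite_induct) (simp_all add: regular_on_const regular_on_mult)

lemma regular_on_power: "regular_on D f \<Longrightarrow> regular_on D (\<lambda>t. f t ^ k)"
  by (induction k) (simp_all add: regular_on_const regular_on_mult)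

lemma regular_on_poly: "regular_on D f \<Longrightarrow> regular_on D (\<lambda>t. poly p (f t))"
  by (induction p) (simp_all add: regular_on_const regular_on_add regular_on_mult)

lemma eventually_cofinite_poly_nonzero:
  fixes p :: "'a::idom poly"
  assumes "p \<noteq> 0"
  shows "eventually (\<lambda>t. poly p t \<noteq> 0) cofinite"
  using poly_roots_finite[OF assms] by (simp add: eventually_cofinite)

text \<open>Identity principle: a nonzero numerator has only finitely many roots, so it cannot
  vanish at almost all points of an infinite field. Hence the numerator is 0, and \<open>f\<close>
  vanishes on all of \<open>D\<close>.\<close>

lemma regular_on_eq_0:
  fixes f :: "'a::field_char_0 \<Rightarrow> 'a"
  assumes "regular_on D f" "eventually (\<lambda>t. t \<in> D) cofinite" "eventually (\<lambda>t. f t = 0) cofinite"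
    and "t \<in> D"
  shows "f t = 0"
proof -
  obtain p q where f: "\<And>t. t \<in> D \<Longrightarrow> poly q t \<noteq> 0" "\<And>t. t \<in> D \<Longrightarrow> f t = poly p t / poly q t"
    using assms(1) by (elim regular_onE) blast
  have "p = 0"
  proof (rule ccontr)
    assume "p \<noteq> 0"
    then have "eventually (\<lambda>t. poly p t \<noteq> 0) cofinite"
      by (rule eventually_cofinite_poly_nonzero)
    \<comment> \<open>Almost every \<open>t\<close> would lie in \<open>D\<close>, be a zero of
      \<open>f\<close> and not be a root of \<open>p\<close>. That no such \<open>t\<close> exists
      would make the field finite.\<close>
    with assms(2,3) have "eventually (\<lambda>t::'a. False) cofinite"
      by eventually_elim (use f in auto)
    then show False by (simp add: infinite_UNIV_char_0)
  qed
  then show ?thesis using f(2)[OF assms(4)] by simp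
qed

text \<open>Evaluation is defined through lowest terms, but any representation may be used where its
  denominator is nonzero: the reduced denominator divides \<open>q\<close>, so reduction creates no
  new pole.\<close>

lemma rat_eval_Fract:
  fixes p q :: "'k::field alg_closure poly"
  assumes "poly q t \<noteq> 0"
  shows "rat_defined_at (Fract p q) t" "rat_eval (Fract p q) t = poly p t / poly q t"
proof -
  define r s where "r = fst (quot_of_fract (Fract p q))" and "s = snd (quot_of_fract (Fract p q))"
  have [simp]: "q \<noteq> 0" "s \<noteq> 0" using assms by (auto simp: s_def)
  have "Fract r s = Fract p q" by (simp add: r_def s_def)
  then have eq: "r * q = p * s" by (simp add: eq_fract)
  have "coprime r s" unfolding r_def s_def by (rule coprime_quot_of_fract)
  moreover have "s dvd r * q" by (simp add: eq)
  ultimately have "s dvd q"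
    by (simp add: coprime_dvd_mult_right_iff coprime_commute)
  then have s: "poly s t \<noteq> 0" using assms by (metis dvdE mult_eq_0_iff poly_mult)
  then show "rat_defined_at (Fract p q) t" by (simp add: rat_defined_at_def s_def)
  have "poly r t * poly q t = poly p t * poly s t"
    using arg_cong[OF eq, of "\<lambda>f. poly f t"] by simp
  then show "rat_eval (Fract p q) t = poly p t / poly q t"
    using s assms unfolding rat_eval_def r_def s_def by (simp add: frac_eq_eq)
qed

lemma eventually_rat_defined_at:
  fixes f :: "'k::field alg_closure poly fract"
  shows "eventually (\<lambda>t. rat_defined_at f t) cofinite"
  unfolding rat_defined_at_def by (rule eventually_cofinite_poly_nonzero) simp

lemma rat_eval_add:
  assumes "rat_defined_at f t" "rat_defined_at g t"
  shows "rat_eval (f + g) t = rat_eval f t + rat_eval g t"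
proof -
  define p q r s where "p = fst (quot_of_fract f)" and "q = snd (quot_of_fract f)"
    and "r = fst (quot_of_fract g)" and "s = snd (quot_of_fract g)"
  have nz: "poly q t \<noteq> 0" "poly s t \<noteq> 0" using assms by (simp_all add: rat_defined_at_def q_def s_def)
  have "f + g = Fract p q + Fract r s" by (simp add: p_def q_def r_def s_def)
  also have "\<dots> = Fract (p * s + r * q) (q * s)" using nz by (intro add_fract) auto
  finally have "rat_eval (f + g) t = poly (p * s + r * q) t / poly (q * s) t"
    using nz by (simp add: rat_eval_Fract)
  then show ?thesis using nz
    by (simp add: add_frac_eq rat_eval_def flip: p_def q_def r_def s_def)
qed

lemma rat_eval_mult_const:
  assumes "rat_defined_at f t"
  shows "rat_eval (f * to_fract [:c:]) t = rat_eval f t * c"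
proof -
  define p q where "p = fst (quot_of_fract f)" and "q = snd (quot_of_fract f)"
  have nz: "poly q t \<noteq> 0" using assms by (simp add: rat_defined_at_def q_def)
  have "f * to_fract [:c:] = Fract p q * Fract [:c:] 1" by (simp add: p_def q_def to_fract_def)
  also have "\<dots> = Fract (p * [:c:]) q" by simp
  finally have "rat_eval (f * to_fract [:c:]) t = poly (p * [:c:]) t / poly q t"
    using nz by (simp only: rat_eval_Fract not_False_eq_True)
  then show ?thesis
    by (simp add: rat_eval_def mult.commute flip: p_def q_def)
qed

text \<open>Additivity of evaluation needs the new summand and the partial sum to be defined. Each
  induction step therefore excludes finitely many further points, which \<open>cofinite\<close>
  absorbs.\<close>

lemma eventually_rat_eval_sum:
  fixes f :: "'i \<Rightarrow> 'k::field alg_closure poly fract"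
  assumes "finite A"
  shows "eventually (\<lambda>t. rat_eval (\<Sum>i\<in>A. f i) t = (\<Sum>i\<in>A. rat_eval (f i) t)) cofinite"
  using assms
proof (induction A)
  case empty
  then show ?case by (simp add: rat_eval_def)
next
  case (insert i A)
  show ?case
    using insert.IH eventually_rat_defined_at[of "f i"] eventually_rat_defined_at[of "sum f A"]
    by eventually_elim (use insert.hyps in \<open>simp add: rat_eval_add\<close>)
qed

lemma regular_on_rat_eval: "regular_on {t. rat_defined_at f t} (rat_eval f)"
  by (rule regular_onI[of _ "snd (quot_of_fract f)" _ "fst (quot_of_fract f)"])
    (auto simp: rat_defined_at_def rat_eval_def)

lemma regular_on_rat_eval_comp:
  assumes "regular_on D v" "\<And>t. t \<in> D \<Longrightarrow> rat_defined_at f (v t)"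
  shows "regular_on D (\<lambda>t. rat_eval f (v t))"
  using assms unfolding rat_eval_def rat_defined_at_def
  by (intro regular_on_divide regular_on_poly) auto

text \<open>The way back from functions to elements of the field of rational functions. It supplies
  the components of a reparametrized curve without an algebraic composition of fractions.\<close>

lemma regular_on_imp_rat_eval:
  fixes f :: "'k::field alg_closure \<Rightarrow> 'k alg_closure"
  assumes "regular_on D f"
  obtains h where "\<And>t. t \<in> D \<Longrightarrow> rat_eval h t = f t"
proof -
  obtain p q where "\<And>t. t \<in> D \<Longrightarrow> poly q t \<noteq> 0" "\<And>t. t \<in> D \<Longrightarrow> f t = poly p t / poly q t"
    using assms by (elim regular_onE) blast
  then have "rat_eval (Fract p q) t = f t" if "t \<in> D" for t
    using that by (simp add: rat_eval_Fract)
  then show ?thesis by (rule that)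
qed

section \<open>Moebius transformations\<close>

lemma eventually_linear_nonzero:
  fixes c d :: "'a::field"
  assumes "c \<noteq> 0 \<or> d \<noteq> 0"
  shows "eventually (\<lambda>t. c * t + d \<noteq> 0) cofinite"
  using eventually_cofinite_poly_nonzero[of "[:d, c:]"] assms
  by (auto simp: algebra_simps)

text \<open>A Moebius map is injective away from its pole, so only finitely many points are sent
  into the finite exceptional set of \<open>P\<close>. The pole adds at most one more.\<close>

lemma eventually_moebius:
  fixes a b c d :: "'a::field"
  assumes det: "a * d - b * c \<noteq> 0" and P: "eventually P cofinite"
  shows "eventually (\<lambda>t. P ((a * t + b) / (c * t + d))) cofinite"
proof -
  let ?v = "\<lambda>t. (a * t + b) / (c * t + d)"
  let ?D = "{t. c * t + d \<noteq> 0}"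
  have "inj_on ?v ?D"
  proof (rule inj_onI)
    fix s t assume "s \<in> ?D" "t \<in> ?D" "?v s = ?v t"
    then have "(a * s + b) * (c * t + d) = (a * t + b) * (c * s + d)"
      by (simp add: frac_eq_eq)
    then have "(a * d - b * c) * (s - t) = 0"
      by (simp add: algebra_simps)
    with det show "s = t" by simp
  qed
  then have "finite (?v -` {x. \<not> P x} \<inter> ?D)"
    using P by (intro finite_vimage_IntI) (simp_all add: eventually_cofinite)
  moreover have "finite (- ?D)"
    using eventually_linear_nonzero[of c d] det
    by (cases "c = 0") (auto simp: eventually_cofinite Collect_neg_eq[symmetric])
  ultimately have "finite ((?v -` {x. \<not> P x} \<inter> ?D) \<union> - ?D)" by simp
  then show ?thesis
    unfolding eventually_cofinite by (rule finite_subset[rotated]) auto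
qed

text \<open>The inverse comes from the adjugate matrix. The signs stay as \<open>- b\<close> and
  \<open>- c\<close> so that it is again a map with coefficients \<open>d\<close>,
  \<open>- b\<close>, \<open>- c\<close>, \<open>a\<close>, to which the lemmas on Moebius maps
  apply directly.\<close>

lemma moebius_inverse:
  fixes a b c d :: "'a::field"
  assumes det: "a * d - b * c \<noteq> 0" and t: "c * t + d \<noteq> 0"
  defines "s \<equiv> (a * t + b) / (c * t + d)"
  shows "(d * s + - b) / (- c * s + a) = t"
proof -
  \<comment> \<open>The denominator of the inverse equals the determinant divided by
    \<open>c * t + d\<close>, hence is nonzero.\<close>
  have "(- c * s + a) * (c * t + d) = a * d - b * c"
    using t unfolding s_def by (simp add: field_simps)
  moreover have "(d * s + - b) * (c * t + d) = t * (a * d - b * c)"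
    using t unfolding s_def by (simp add: field_simps)
  ultimately have "(d * s + - b) * (c * t + d) = t * (- c * s + a) * (c * t + d)" "- c * s + a \<noteq> 0"
    using det by (auto simp: mult.assoc)
  then show ?thesis using t by (simp add: divide_eq_eq del: mult_minus_left)
qed

section \<open>Zariski closures of rational curves\<close>

lemma eventually_tuple_defined_at:
  fixes \<phi> :: "nat \<Rightarrow> 'k::field alg_closure poly fract"
  shows "eventually (\<lambda>t. tuple_defined_at n \<phi> t) cofinite"
proof -
  have "eventually (\<lambda>t. \<forall>i\<in>{..<n}. rat_defined_at (\<phi> i) t) cofinite"
    by (intro eventually_ball_finite) (auto intro: eventually_rat_defined_at)
  then show ?thesis by (simp add: tuple_defined_at_def Ball_def)
qed

lemma regular_on_multipoly_tuple_eval: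
  assumes "p \<in> multipoly_ring n"
  shows "regular_on {t. tuple_defined_at n \<phi> t} (\<lambda>t. multipoly_eval p (tuple_eval n \<phi> t))"
  unfolding multipoly_eval_def
proof (intro regular_on_sum regular_on_mult regular_on_const regular_on_prod regular_on_power)
  fix m i assume "m \<in> Poly_Mapping.keys p" "i \<in> Poly_Mapping.keys m"
  \<comment> \<open>Variables of \<open>p\<close> have index below \<open>n\<close>, exactly the
    range in which \<open>tuple_defined_at\<close> excludes poles.\<close>
  then have i: "i < n" using assms unfolding multipoly_ring_def by blast
  then have "{t. tuple_defined_at n \<phi> t} \<subseteq> {t. rat_defined_at (\<phi> i) t}"
    by (auto simp: tuple_defined_at_def)
  then show "regular_on {t. tuple_defined_at n \<phi> t} (\<lambda>t. tuple_eval n \<phi> t i)"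
    using regular_on_rat_eval[of "\<phi> i"] i
    unfolding regular_on_def tuple_eval_def by (simp add: subset_iff) blast
qed

text \<open>By the identity principle, vanishing at almost all parameters extends to every parameter
  where the tuple is defined. The closure is thus insensitive to finitely many parameters.\<close>

lemma multipoly_vanishes_on_curve_iff:
  fixes \<phi> :: "nat \<Rightarrow> 'k::field_char_0 alg_closure poly fract"
  assumes "p \<in> multipoly_ring n"
  shows "(\<forall>y\<in>{tuple_eval n \<phi> t | t. tuple_defined_at n \<phi> t}. multipoly_eval p y = 0) \<longleftrightarrow>
    eventually (\<lambda>t. multipoly_eval p (tuple_eval n \<phi> t) = 0) cofinite" (is "?L \<longleftrightarrow> ?R")
proof
  assume ?L
  show ?R
    using eventually_tuple_defined_at[of n \<phi>] by eventually_elim (use \<open>?L\<close> in blast)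
next
  assume ?R
  then show ?L
    using regular_on_eq_0[OF regular_on_multipoly_tuple_eval[OF assms, of \<phi>]]
      eventually_tuple_defined_at[of n \<phi>]
    by auto
qed

lemma zariski_closure_curve:
  fixes \<phi> :: "nat \<Rightarrow> 'k::field_char_0 alg_closure poly fract"
  shows "zariski_closure n {tuple_eval n \<phi> t | t. tuple_defined_at n \<phi> t} =
    {x \<in> aff_space n. \<forall>p\<in>multipoly_ring n.
       eventually (\<lambda>t. multipoly_eval p (tuple_eval n \<phi> t) = 0) cofinite \<longrightarrow> multipoly_eval p x = 0}"
  unfolding zariski_closure_def by (auto simp only: multipoly_vanishes_on_curve_iff)

lemma tuple_eval_in_curve:
  assumes "parametrizes n \<phi> U" "tuple_defined_at n \<phi> t"
  shows "tuple_eval n \<phi> t \<in> U"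
  using assms unfolding parametrizes_def zariski_closure_def
  by (auto simp: aff_space_def tuple_eval_def)

lemma polynomial_function_vanishes_on_curve:
  fixes \<phi> :: "nat \<Rightarrow> 'k::field_char_0 alg_closure poly fract"
  assumes "parametrizes n \<phi> U" "polynomial_function n f"
    and "eventually (\<lambda>t. f (tuple_eval n \<phi> t) = 0) cofinite" "x \<in> U"
  shows "f x = 0"
proof -
  obtain p where p: "p \<in> multipoly_ring n" "\<And>x. multipoly_eval p x = f x"
    using assms(2) unfolding polynomial_function_def by blast
  have "multipoly_eval p x = 0"
    using assms(1,3,4) p unfolding parametrizes_def zariski_closure_curve by auto
  then show ?thesis by (simp add: p)
qed

text \<open>The closure depends only on which polynomials vanish at almost all parameters. This
  property is carried from \<open>\<psi>\<close> to \<open>\<phi>\<close> by substituting the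
  Moebius map, and back by substituting its inverse.\<close>

lemma parametrizes_reparam:
  fixes \<phi> \<psi> :: "nat \<Rightarrow> 'k::field_char_0 alg_closure poly fract"
  assumes "parametrizes n \<phi> U"
    and det: "a * d - b * c \<noteq> 0"
    and \<psi>: "eventually (\<lambda>t. tuple_eval n \<psi> ((a * t + b) / (c * t + d)) = tuple_eval n \<phi> t) cofinite"
  shows "parametrizes n \<psi> U"
proof -
  have det': "d * a - (- b) * (- c) \<noteq> 0" using det by (simp add: mult.commute)
  have "eventually (\<lambda>t. f (tuple_eval n \<phi> t) = 0) cofinite \<longleftrightarrow>
      eventually (\<lambda>t. f (tuple_eval n \<psi> t) = 0) cofinite" (is "?L \<longleftrightarrow> ?R")
    for f :: "(nat \<Rightarrow> 'k alg_closure) \<Rightarrow> 'k alg_closure"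
  proof
    assume ?R
    from eventually_moebius[OF det this] \<psi> show ?L
      by eventually_elim simp
  next
    assume ?L
    with \<psi> have *:
      "eventually (\<lambda>t. f (tuple_eval n \<psi> ((a * t + b) / (c * t + d))) = 0) cofinite"
      by eventually_elim simp
    have "- c \<noteq> 0 \<or> a \<noteq> 0" using det by auto
    \<comment> \<open>Substituting the inverse into \<open>*\<close> gives a nested argument, which
      collapses to \<open>s\<close> wherever \<open>s\<close> is not the pole of the
      inverse.\<close>
    from eventually_conj[OF eventually_moebius[OF det' *] eventually_linear_nonzero[OF this]]
    have "eventually (\<lambda>s. f (tuple_eval n \<psi> ((a * ((d * s + - b) / (- c * s + a)) + b) /
        (c * ((d * s + - b) / (- c * s + a)) + d))) = 0 \<and> - c * s + a \<noteq> 0) cofinite"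
      .
    then show ?R
    proof eventually_elim
      case (elim s)
      then show ?case using moebius_inverse[OF det', of s] by simp
    qed
  qed
  then show ?thesis
    using assms(1) unfolding parametrizes_def zariski_closure_curve by simp
qed

section \<open>Hyperplane sections of a hypercircle\<close>

lemma hypercircle_moebius_inverse_param:
  fixes \<alpha> :: "'k::field_char_0 alg_closure"
  assumes "is_hypercircle \<alpha> U"
  obtains \<psi> where "parametrizes (ext_degree \<alpha>) \<psi> U"
    "eventually (\<lambda>t. (\<Sum>i<ext_degree \<alpha>. rat_eval (\<psi> i) t * \<alpha> ^ i) = t) cofinite"
proof -
  define n where "n = ext_degree \<alpha>"
  obtain u \<phi> where u: "u \<in> unit_ratfuns \<alpha>" and exp: "is_expansion \<alpha> u \<phi>"
    and par: "parametrizes n \<phi> U"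
    using assms unfolding is_hypercircle_def n_def by blast
  obtain a b c d where u_eq: "u = Fract [:b, a:] [:d, c:]" and det: "a * d - b * c \<noteq> 0"
    using u unfolding unit_ratfuns_def by blast
  \<comment> \<open>\<open>w\<close> is the unit \<open>u\<close> as a function and \<open>v\<close>
    is its inverse; they cancel only away from the respective poles.\<close>
  define w where "w = (\<lambda>t. (a * t + b) / (c * t + d))"
  define v where "v = (\<lambda>t. (d * t + - b) / (- c * t + a))"
  have det': "d * a - (- b) * (- c) \<noteq> 0" using det by (simp add: mult.commute)
  have w: "eventually (\<lambda>t. c * t + d \<noteq> 0) cofinite"
    using det by (intro eventually_linear_nonzero) auto
  have v: "eventually (\<lambda>t. - c * t + a \<noteq> 0) cofinite"
    using det by (intro eventually_linear_nonzero) auto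
  have vw: "v (w t) = t" if "c * t + d \<noteq> 0" for t
    using moebius_inverse[OF det that] by (simp add: v_def w_def)
  have wv: "w (v t) = t" if "- c * t + a \<noteq> 0" for t
    using moebius_inverse[OF det' that] by (simp add: v_def w_def)
  \<comment> \<open>The expansion of \<open>u\<close> is an identity of formal fractions; evaluating
    it termwise requires a parameter that is no pole of \<open>u\<close> or of any
    component.\<close>
  have sum_\<phi>: "eventually (\<lambda>t. (\<Sum>i<n. rat_eval (\<phi> i) t * \<alpha> ^ i) = w t) cofinite"
    using eventually_rat_eval_sum[of "{..<n}" "\<lambda>i. \<phi> i * to_fract [:\<alpha> ^ i:]", simplified]
      eventually_tuple_defined_at[of n \<phi>] w
  proof eventually_elim
    case (elim t)
    have "rat_eval u t = w t"
      using elim(3) unfolding u_eq w_def by (subst rat_eval_Fract) (simp_all add: algebra_simps)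
    moreover have "rat_eval u t = (\<Sum>i<n. rat_eval (\<phi> i * to_fract [:\<alpha> ^ i:]) t)"
      using exp elim(1) by (simp add: is_expansion_def n_def)
    moreover have "\<dots> = (\<Sum>i<n. rat_eval (\<phi> i) t * \<alpha> ^ i)"
      using elim(2) by (intro sum.cong) (auto simp: tuple_defined_at_def rat_eval_mult_const)
    ultimately show ?case by simp
  qed
  \<comment> \<open>On \<open>D\<close> the composites of the components of \<open>\<phi>\<close>
    with \<open>v\<close> have no poles, so each is the value function of some fraction.\<close>
  define D where "D = {t. - c * t + a \<noteq> 0 \<and> tuple_defined_at n \<phi> (v t)}"
  have D: "eventually (\<lambda>t. t \<in> D) cofinite"
    using eventually_conj[OF v eventually_moebius[OF det' eventually_tuple_defined_at[of n \<phi>]]]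
    by (simp add: D_def v_def)
  have "regular_on D v"
    by (rule regular_onI[of D "[:a, - c:]" _ "[:- b, d:]"])
      (auto simp: D_def v_def algebra_simps)
  then have "regular_on D (\<lambda>t. rat_eval (\<phi> i) (v t))" if "i < n" for i
    using that by (intro regular_on_rat_eval_comp) (auto simp: D_def tuple_defined_at_def)
  \<comment> \<open>The guard \<open>i < n\<close> is placed under the existential so that choice
    yields \<open>\<psi>\<close> as a total function of the index.\<close>
  then have "\<forall>i. \<exists>h. i < n \<longrightarrow> (\<forall>t\<in>D. rat_eval h t = rat_eval (\<phi> i) (v t))"
    using regular_on_imp_rat_eval by metis
  then obtain \<psi> where \<psi>: "\<And>i t. i < n \<Longrightarrow> t \<in> D \<Longrightarrow> rat_eval (\<psi> i) t = rat_eval (\<phi> i) (v t)"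
    by metis
  show ?thesis
  proof (rule that; fold n_def)
    have "eventually (\<lambda>t. tuple_eval n \<psi> (w t) = tuple_eval n \<phi> t) cofinite"
      using eventually_moebius[OF det D] w
    proof eventually_elim
      case (elim t)
      then have "w t \<in> D" by (simp add: w_def)
      then show ?case
        using \<psi>[of _ "w t"] vw[OF elim(2)] by (auto simp: tuple_eval_def restrict_def)
    qed
    then show "parametrizes n \<psi> U"
      unfolding w_def by (rule parametrizes_reparam[OF par det])
    show "eventually (\<lambda>t. (\<Sum>i<n. rat_eval (\<psi> i) t * \<alpha> ^ i) = t) cofinite"
      using eventually_moebius[OF det' sum_\<phi>] D v
    proof eventually_elim
      case (elim t)
      have "(\<Sum>i<n. rat_eval (\<psi> i) t * \<alpha> ^ i) = (\<Sum>i<n. rat_eval (\<phi> i) (v t) * \<alpha> ^ i)"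
        using elim(2) by (intro sum.cong) (simp_all add: \<psi>)
      then show ?case using elim(1) wv[OF elim(3)] by (simp add: v_def)
    qed
  qed
qed

text \<open>On the curve the linear form recovers the parameter, so each coordinate is a fixed
  rational function of it. Cleared of denominators, this relation extends to the closure;
  definedness at \<open>t\<close> then allows dividing by the denominator again.\<close>

lemma curve_point_on_pencil_hyperplane:
  fixes \<alpha> :: "'k::field_char_0 alg_closure"
  defines "n \<equiv> ext_degree \<alpha>"
  assumes par: "parametrizes n \<psi> U"
    and sum_\<psi>: "eventually (\<lambda>t. (\<Sum>i<n. rat_eval (\<psi> i) t * \<alpha> ^ i) = t) cofinite"
    and t: "tuple_defined_at n \<psi> t" and x: "x \<in> pencil_hyperplane \<alpha> t" "x \<in> U"
  shows "x = tuple_eval n \<psi> t"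
proof -
  have xi: "x i = rat_eval (\<psi> i) t" if i: "i < n" for i
  proof -
    define p q where "p = fst (quot_of_fract (\<psi> i))" and "q = snd (quot_of_fract (\<psi> i))"
    define L where "L = (\<lambda>x. \<Sum>j<n. x j * \<alpha> ^ j)"
    have L: "polynomial_function n L"
      unfolding L_def
      by (intro polynomial_function_sum polynomial_function_mult polynomial_function_const
          polynomial_function_coord) auto
    have "poly q (L x) * x i - poly p (L x) = 0"
    proof (rule polynomial_function_vanishes_on_curve[OF par _ _ x(2)])
      show "polynomial_function n (\<lambda>x. poly q (L x) * x i - poly p (L x))"
        using i
        by (intro polynomial_function_diff polynomial_function_mult polynomial_function_poly L
            polynomial_function_coord)
      show "eventually (\<lambda>s. poly q (L (tuple_eval n \<psi> s)) * tuple_eval n \<psi> s i -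
          poly p (L (tuple_eval n \<psi> s)) = 0) cofinite"
        using sum_\<psi> eventually_rat_defined_at[of "\<psi> i"]
      proof eventually_elim
        case (elim s)
        have "L (tuple_eval n \<psi> s) = s" using elim(1) by (simp add: L_def tuple_eval_def)
        then show ?case
          using elim(2) i by (simp add: tuple_eval_def rat_eval_def rat_defined_at_def p_def q_def)
      qed
    qed
    moreover have "L x = t" using x(1) by (simp add: pencil_hyperplane_def L_def n_def)
    moreover have "poly q t \<noteq> 0" using t i by (simp add: tuple_defined_at_def rat_defined_at_def q_def)
    ultimately show ?thesis
      by (simp add: rat_eval_def eq_divide_eq mult.commute flip: p_def q_def)
  qed
  \<comment> \<open>Points of \<open>aff_space n\<close> are \<open>undefined\<close> at indices
    from \<open>n\<close> on, so agreement of the first \<open>n\<close> coordinates gives equality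
    of functions.\<close>
  have "x \<in> aff_space n" using x(1) by (simp add: pencil_hyperplane_def n_def)
  then show ?thesis
    using xi by (auto simp: aff_space_def tuple_eval_def PiE_def extensional_def fun_eq_iff)
qed

theorem proposition5p1:
  fixes \<alpha> :: "'k::field_char_0 alg_closure"
    and U :: "(nat \<Rightarrow> 'k alg_closure) set"
    and n :: nat
  assumes "n = ext_degree \<alpha>"
    and "is_primitive_hypercircle \<alpha> U"
  shows "\<exists>\<psi> :: nat \<Rightarrow> 'k alg_closure poly fract.
           finite {t. \<not> (tuple_defined_at n \<psi> t \<and>
                         pencil_hyperplane \<alpha> t \<inter> U = {tuple_eval n \<psi> t})} \<and>
           parametrizes n \<psi> U"
proof -
  obtain \<psi> where par: "parametrizes n \<psi> U"
    and sum_\<psi>: "eventually (\<lambda>t. (\<Sum>i<n. rat_eval (\<psi> i) t * \<alpha> ^ i) = t) cofinite"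
    using assms hypercircle_moebius_inverse_param[of \<alpha> U]
    unfolding is_primitive_hypercircle_def by auto
  have "eventually (\<lambda>t. tuple_defined_at n \<psi> t \<and>
      pencil_hyperplane \<alpha> t \<inter> U = {tuple_eval n \<psi> t}) cofinite"
    using eventually_tuple_defined_at[of n \<psi>] sum_\<psi>
  proof eventually_elim
    case (elim t)
    \<comment> \<open>Membership in the hyperplane is precisely the identity
      \<open>sum_\<psi>\<close> at this parameter.\<close>
    have "tuple_eval n \<psi> t \<in> pencil_hyperplane \<alpha> t"
      using elim(2) by (simp add: pencil_hyperplane_def aff_space_def tuple_eval_def assms(1))
    moreover have "tuple_eval n \<psi> t \<in> U"
      using par elim(1) by (rule tuple_eval_in_curve)
    moreover have "x = tuple_eval n \<psi> t" if "x \<in> pencil_hyperplane \<alpha> t" "x \<in> U" for x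
      using curve_point_on_pencil_hyperplane[of \<alpha> \<psi> U t x] par sum_\<psi> elim(1) that assms(1) by simp
    ultimately show ?case using elim(1) by blast
  qed
  then show ?thesis using par unfolding eventually_cofinite by blast
qed

end
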